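(* Let $I\subset[0,\infty)$ be an interval, let $a,b\in I$ with $a<b$, and let $f:I\to\mathbb{R}$ be differentiable on the interior $I^{\circ}$ of $I$ and at $a$ and $b$, with $f'\in L[a,b]$. Let $q\ge 1$, let $s\in(0,1]$ be fixed, and suppose that $|f'|^q$ is $s$-convex in the second sense on $[a,b]$. Then for each $x\in[a,b]$, $$\begin{aligned}\left|f(x)-\frac{1}{b-a}\int_a^b f(u)\,du\right|\le{}& (b-a)\Big(\frac12\Big)^{1-\frac1q}\Big(\frac{b-x}{b-a}\Big)^{2(1-1/q)}\Big[\frac{1}{s+2}\Big(\frac{b-x}{b-a}\Big)^{s+2}|f'(a)|^q\\&+\Big(\frac{1}{s+2}\Big(\frac{x-a}{b-a}\Big)^{s+2}-\frac{1}{s+1}\Big(\frac{x-a}{b-a}\Big)^{s+1}+\frac{1}{(s+1)(s+2)}\Big)|f'(b)|^q\Big]^{\frac1q}\\&+(b-a)\Big(\frac12\Big)^{1-\frac1q}\Big(\frac{x-a}{b-a}\Big)^{2(1-1/q)}\Big[\frac{1}{s+2}\Big(\frac{x-a}{b-a}\Big)^{s+2}|f'(b)|^q\\&+\Big(\frac{1}{s+2}\Big(\frac{b-x}{b-a}\Big)^{s+2}-\frac{1}{s+1}\Big(\frac{b-x}{b-a}\Big)^{s+1}+\frac{1}{(s+1)(s+2)}\Big)|f'(a)|^q\Big]^{\frac1q}.\end{aligned}$$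
   Context: For fixed $s\in(0,1]$, a real function $g$ is $s$-convex in the second sense on $[a,b]\subset[0,\infty)$ if $g(\alpha x+(1-\alpha)y)\le \alpha^s g(x)+(1-\alpha)^s g(y)$ for all $x,y\in[a,b]$ and $\alpha\in[0,1]$. $L[a,b]$ denotes the Lebesgue integrable functions on $[a,b]$. If $a$ or $b$ is an endpoint of $I$, differentiability there is one-sided (within $I$). *)

theory Defs
  imports "HOL-Analysis.Analysis"
begin

(* Intended for 0 < s <= 1 and 0 <= a; for such s, "0 powr s = 0" is the usual value. *)
definition s_convex_second_sense :: "real \<Rightarrow> real \<Rightarrow> real \<Rightarrow> (real \<Rightarrow> real) \<Rightarrow> bool" where
  "s_convex_second_sense s a b g \<longleftrightarrow>
     (\<forall>x\<in>{a..b}. \<forall>y\<in>{a..b}. \<forall>\<alpha>\<in>{0..1}.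
        g (\<alpha> * x + (1 - \<alpha>) * y) \<le> \<alpha> powr s * g x + (1 - \<alpha>) powr s * g y)"

(* On "0 powr 0 = 0" versus the usual 0^0 = 1: a factor ((b - x) / (b - a)) powr (2 * (1 - 1/q))
   is affected only for q = 1 and x = b, where the bracket it multiplies vanishes because
   1/(s+2) - 1/(s+1) + 1/((s+1)(s+2)) = 0; symmetrically for x = a. *)

end

theory Submission
  imports Defs
begin

text \<open>
  Substituting $u = ta + (1-t)b$ and $u = tb + (1-t)a$ in the Montgomery identity turns the deviation
  of $f(x)$ from its mean into $(b-a)$ times a difference of two integrals $\int_0^X t\,f'(\cdot)\,dt$
  with $X = (b-x)/(b-a)$ and $X = (x-a)/(b-a)$. In each of them $|f'|^q$ is dominated by
  $t^s A + (1-t)^s B$, whose integral against $t$ is a constant $K$. Instead of Hoelder's inequality one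
  uses Young's inequality pointwise, with the parameter $c = 2K/X^2$ (the mean of the majorant with
  respect to the weight $t$).
\<close>

text \<open>This evaluates the constant \<open>K\<close>. Writing \<open>t = 1 - (1 - t)\<close>
  turns \<open>t * (1 - t) powr s\<close> into \<open>(1 - t) powr s - (1 - t) powr (s + 1)\<close>,
  so every term has an explicit primitive.\<close>

lemma has_integral_powr_weight:
  fixes X s A B :: real
  assumes "0 \<le> X" "X \<le> 1" "0 < s"
  shows "((\<lambda>t. t * (t powr s * A + (1 - t) powr s * B)) has_integral
     (1 / (s + 2) * X powr (s + 2) * A
       + (1 / (s + 2) * (1 - X) powr (s + 2) - 1 / (s + 1) * (1 - X) powr (s + 1)
          + 1 / ((s + 1) * (s + 2))) * B)) {0..X}"
proof -
  define P where "P t = 1 / (s + 2) * t powr (s + 2) * A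
      + (1 / (s + 2) * (1 - t) powr (s + 2) - 1 / (s + 1) * (1 - t) powr (s + 1)) * B" for t
  have "((\<lambda>t. t * (t powr s * A + (1 - t) powr s * B)) has_integral (P X - P 0)) {0..X}"
  \<comment> \<open>The power rule is used only for positive bases; \<open>t\<close> vanishes at 0,
    and \<open>1 - t\<close> vanishes at the right end when \<open>X = 1\<close>. Continuity of
    \<open>P\<close> covers the endpoints.\<close>
  proof (rule fundamental_theorem_of_calculus_interior)
    show "continuous_on {0..X} P"
      unfolding P_def using assms
      by (intro continuous_on_add continuous_on_diff continuous_on_mult continuous_on_powr'
          continuous_on_const continuous_on_id) auto
    fix t assume "t \<in> {0<..<X}"
    then have t: "0 < t" "t < 1" using assms by auto
    have "(P has_real_derivative
        (1 / (s + 2) * ((s + 2) * t powr (s + 1)) * A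
         + (1 / (s + 2) * (- ((s + 2) * (1 - t) powr (s + 1)))
            - 1 / (s + 1) * (- ((s + 1) * (1 - t) powr s))) * B)) (at t)"
      unfolding P_def using t assms by (auto intro!: derivative_eq_intros simp: add.commute)
    also have "1 / (s + 2) * ((s + 2) * t powr (s + 1)) * A
         + (1 / (s + 2) * (- ((s + 2) * (1 - t) powr (s + 1)))
            - 1 / (s + 1) * (- ((s + 1) * (1 - t) powr s))) * B
        = t * (t powr s * A + (1 - t) powr s * B)"
    proof -
      have "1 / d * (d * y) = y" "1 / d * (- (d * y)) = - y" if "0 < d" for d y :: real
        using that by simp_all
      then show ?thesis
        using t assms by (simp only: powr_add) (simp add: algebra_simps)
    qed
    finally show "(P has_vector_derivative t * (t powr s * A + (1 - t) powr s * B)) (at t)"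
      by (simp add: has_real_derivative_iff_has_vector_derivative)
  qed (use assms in auto)
  moreover have "P X - P 0 = 1 / (s + 2) * X powr (s + 2) * A
       + (1 / (s + 2) * (1 - X) powr (s + 2) - 1 / (s + 1) * (1 - X) powr (s + 1)
          + 1 / ((s + 1) * (s + 2))) * B"
  proof -
    \<comment> \<open>The constant term of the bracket is \<open>- P 0\<close>: at 0 the summand
      with \<open>A\<close> vanishes and both powers of \<open>1 - t\<close> equal 1.\<close>
    have "1 / (s + 1) - 1 / (s + 2) = 1 / ((s + 1) * (s + 2))"
      using assms by (simp add: field_simps)
    then have "1 / ((s + 1) * (s + 2)) * B = 1 / (s + 1) * B - 1 / (s + 2) * B"
      by (metis left_diff_distrib)
    then show ?thesis
      using assms by (simp add: P_def algebra_simps)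
  qed
  ultimately show ?thesis by simp
qed

text \<open>A power mean inequality for the weight \<open>t\<close> on \<open>{0..X}\<close>, whose
  total mass is \<open>X\<^sup>2 / 2\<close>: the first two factors of the bound are this mass to
  the power \<open>1 - 1/q\<close>.\<close>

lemma weighted_power_mean_bound:
  fixes \<phi> R :: "real \<Rightarrow> real" and J K X q :: real
  assumes "0 \<le> X" "q \<ge> 1"
    and contR: "continuous_on {0..X} R"
    and bound: "\<And>t. t \<in> {0..X} \<Longrightarrow> \<bar>\<phi> t\<bar> powr q \<le> R t"
    and K: "((\<lambda>t. t * R t) has_integral K) {0..X}"
    and J: "((\<lambda>t. t * \<phi> t) has_integral J) {0..X}"
  shows "\<bar>J\<bar> \<le> (1/2) powr (1 - 1/q) * X powr (2 * (1 - 1/q)) * K powr (1/q)"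
\<comment> \<open>In these degenerate cases the Young parameter is not a positive number, so
  \<open>J = 0\<close> is shown directly.\<close>
proof (cases "X = 0 \<or> K = 0")
  case True
  have R: "0 \<le> R t" if "t \<in> {0..X}" for t
    using bound[OF that] powr_ge_zero order_trans by blast
  have zero: "t * \<phi> t = 0" if t: "t \<in> {0..X}" for t
  proof (cases "X = 0")
    case True
    then show ?thesis using t by simp
  next
    case False
    \<comment> \<open>Here \<open>K = 0\<close>, and a continuous nonnegative function with integral
      0 vanishes. Hence \<open>R t = 0\<close> for \<open>t > 0\<close>, which forces \<phi> to
      vanish there too.\<close>
    have "\<forall>t\<in>{0..X}. t * R t = 0"
    proof (subst integral_eq_0_iff[symmetric])
      show "continuous_on {0..X} (\<lambda>t. t * R t)"
        by (intro continuous_intros contR)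
      show "integral {0..X} (\<lambda>t. t * R t) = 0"
        using integral_unique[OF K] True False by simp
    qed (use R False assms in auto)
    then show ?thesis
      using t bound[OF t] by (cases "t = 0") auto
  qed
  have "((\<lambda>t. t * \<phi> t) has_integral 0) {0..X}"
    by (rule has_integral_is_0) (rule zero)
  then have "J = 0" using J has_integral_unique by blast
  then show ?thesis by simp
next
  case False
  have R: "0 \<le> R t" if "t \<in> {0..X}" for t
    using bound[OF that] powr_ge_zero order_trans by blast
  have "0 \<le> K"
    using K by (rule has_integral_nonneg) (use R in auto)
  with False assms have pos: "0 < X" "0 < K" by auto
  define c where "c = K / (X\<^sup>2 / 2)"
  have c: "0 < c" using pos by (simp add: c_def)
  have young: "\<bar>\<phi> t\<bar> * c powr (1 - 1/q) \<le> 1/q * R t + (1 - 1/q) * c" if t: "t \<in> {0..X}" for t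
  proof -
    \<comment> \<open>Young's inequality with weights \<open>1/q\<close> and \<open>1 - 1/q\<close>.
      It is applied to positive numbers, hence the separate case of a zero of \<phi>.\<close>
    have "(\<bar>\<phi> t\<bar> powr q) powr (1/q) * c powr (1 - 1/q) \<le> 1/q * \<bar>\<phi> t\<bar> powr q + (1 - 1/q) * c"
    proof (cases "\<phi> t = 0")
      case True
      then show ?thesis using assms c by simp
    next
      case False
      then show ?thesis using assms c by (intro Youngs_inequality_0) auto
    qed
    also have "\<dots> \<le> 1/q * R t + (1 - 1/q) * c"
      using bound[OF t] assms by (intro add_right_mono mult_left_mono) auto
    finally show ?thesis using assms by (simp add: powr_powr)
  qed
  have "((\<lambda>t. t) has_integral (X\<^sup>2/2)) {0..X}"
    using ident_has_integral[of 0 X] pos by simp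
  then have "((\<lambda>t. t * R t * (1/q) + t * ((1 - 1/q) * c)) has_integral
      (K * (1/q) + (X\<^sup>2/2) * ((1 - 1/q) * c))) {0..X}"
    by (intro has_integral_add has_integral_mult_left K) auto
  \<comment> \<open>The choice of \<open>c\<close> as a mean pays off: the constant \<open>c\<close>
    integrates against \<open>t\<close> to \<open>K\<close>, so the convex combination of
    \<open>R t\<close> and \<open>c\<close> does as well.\<close>
  moreover have "K * (1/q) + (X\<^sup>2/2) * ((1 - 1/q) * c) = K"
    using pos by (simp add: c_def field_simps)
  ultimately have maj: "((\<lambda>t. t * R t * (1/q) + t * ((1 - 1/q) * c)) has_integral K) {0..X}"
    by simp
  have J': "((\<lambda>t. t * \<phi> t * c powr (1 - 1/q)) has_integral J * c powr (1 - 1/q)) {0..X}"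
    by (intro has_integral_mult_left J)
  have "norm (integral {0..X} (\<lambda>t. t * \<phi> t * c powr (1 - 1/q)))
      \<le> integral {0..X} (\<lambda>t. t * R t * (1/q) + t * ((1 - 1/q) * c))"
  proof (rule integral_norm_bound_integral)
    fix t assume t: "t \<in> {0..X}"
    show "norm (t * \<phi> t * c powr (1 - 1/q)) \<le> t * R t * (1/q) + t * ((1 - 1/q) * c)"
      using mult_left_mono[OF young[OF t], of t] t by (simp add: abs_mult algebra_simps)
  qed (use J' maj in \<open>auto simp: integrable_on_def\<close>)
  then have "\<bar>J\<bar> * c powr (1 - 1/q) \<le> K"
    unfolding integral_unique[OF J'] integral_unique[OF maj] by (simp add: abs_mult)
  then have "\<bar>J\<bar> \<le> K / c powr (1 - 1/q)"
    using c by (simp add: field_simps)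
  \<comment> \<open>The exponent, equal to \<open>1/q\<close>, keeps this shape because it arises as
    \<open>K\<close> divided by the factor \<open>K powr (1 - 1/q)\<close> contained in the power of
    \<open>c\<close>.\<close>
  also have "\<dots> = K powr (1 - (1 - 1/q)) * (X\<^sup>2 / 2) powr (1 - 1/q)"
    using pos unfolding c_def powr_diff[of K 1] powr_divide[of K "X\<^sup>2 / 2"] by simp
  also have "(X\<^sup>2 / 2) powr (1 - 1/q) = (1/2) powr (1 - 1/q) * X powr (2 * (1 - 1/q))"
    using pos by (simp add: powr_divide powr_powr flip: powr_numeral)
  finally show ?thesis by (simp add: mult_ac)
qed

text \<open>Integration by parts along the segment that starts at \<open>r\<close> for
  \<open>t = 0\<close> and heads for \<open>p\<close>, with \<Phi> a primitive of \<open>f\<close>.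
  The pairs \<open>(a, b)\<close> and \<open>(b, a)\<close> for \<open>(p, r)\<close> give the two
  halves of the Montgomery identity.\<close>

lemma montgomery_half_has_integral:
  fixes f f' \<Phi> :: "real \<Rightarrow> real" and p r X :: real and S :: "real set"
  assumes "p \<noteq> r" "0 \<le> X" "X \<le> 1" "closed_segment r p \<subseteq> S"
    and f: "\<And>u. u \<in> S \<Longrightarrow> (f has_real_derivative f' u) (at u within S)"
    and \<Phi>: "\<And>u. u \<in> S \<Longrightarrow> (\<Phi> has_real_derivative f u) (at u within S)"
  shows "((\<lambda>t. t * f' (t * p + (1 - t) * r)) has_integral
     (X * f (X * p + (1 - X) * r) / (p - r)
       - (\<Phi> (X * p + (1 - X) * r) - \<Phi> r) / (p - r)\<^sup>2)) {0..X}"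
proof -
  define u where "u t = t * p + (1 - t) * r" for t
  define H where "H t = t * f (u t) / (p - r) - \<Phi> (u t) / (p - r)\<^sup>2" for t
  have uS: "u ` {0..X} \<subseteq> S"
    using assms(2-4) by (force simp: u_def closed_segment_def)
  have du: "(u has_real_derivative p - r) (at t within {0..X})" for t
    unfolding u_def by (auto intro!: derivative_eq_intros)
  \<comment> \<open>The outer derivative is restricted to the image of the path, so one-sided
    derivatives at the ends of \<open>S\<close> suffice.\<close>
  have chain: "((\<lambda>t. g (u t)) has_real_derivative g' * (p - r)) (at t within {0..X})"
    if "t \<in> {0..X}" "(g has_real_derivative g') (at (u t) within S)" for g g' t
    using DERIV_image_chain[OF DERIV_subset[OF that(2) uS] du] by (simp add: o_def)
  have "((\<lambda>t. t * f' (u t)) has_integral (H X - H 0)) {0..X}"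
  proof (rule fundamental_theorem_of_calculus)
    fix t assume t: "t \<in> {0..X}"
    then have S: "u t \<in> S" using uS by auto
    have "(H has_real_derivative
        ((1 * f (u t) + (f' (u t) * (p - r)) * t) / (p - r) - f (u t) * (p - r) / (p - r)\<^sup>2))
        (at t within {0..X})"
      unfolding H_def
      by (intro DERIV_diff DERIV_cdivide DERIV_mult DERIV_ident chain[OF t] f \<Phi> S)
    also have "(1 * f (u t) + (f' (u t) * (p - r)) * t) / (p - r) - f (u t) * (p - r) / (p - r)\<^sup>2
        = t * f' (u t)"
      using assms(1) by (simp add: power2_eq_square add_divide_distrib)
    finally show "(H has_vector_derivative t * f' (u t)) (at t within {0..X})"
      by (simp add: has_real_derivative_iff_has_vector_derivative)
  qed (use assms in auto)
  moreover have "H X - H 0 = X * f (X * p + (1 - X) * r) / (p - r)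
       - (\<Phi> (X * p + (1 - X) * r) - \<Phi> r) / (p - r)\<^sup>2"
    by (simp add: H_def u_def diff_divide_distrib)
  ultimately show ?thesis by (simp add: u_def)
qed

theorem theorem11:
  fixes I :: "real set" and f f' :: "real \<Rightarrow> real" and a b q s x :: real
  assumes "is_interval I" and "I \<subseteq> {0..}"
    and "a \<in> I" and "b \<in> I" and "a < b"
    and "\<And>u. u \<in> interior I \<union> {a, b} \<Longrightarrow> (f has_real_derivative f' u) (at u within I)"
    and "f' absolutely_integrable_on {a..b}"
    and "q \<ge> 1" and "0 < s" and "s \<le> 1"
    and "s_convex_second_sense s a b (\<lambda>u. \<bar>f' u\<bar> powr q)"
    and "x \<in> {a..b}"
  shows "\<bar>f x - 1 / (b - a) * integral {a..b} f\<bar> \<le>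
      (b - a) * (1/2) powr (1 - 1/q) * ((b - x) / (b - a)) powr (2 * (1 - 1/q))
        * (1 / (s + 2) * ((b - x) / (b - a)) powr (s + 2) * \<bar>f' a\<bar> powr q
           + (1 / (s + 2) * ((x - a) / (b - a)) powr (s + 2)
              - 1 / (s + 1) * ((x - a) / (b - a)) powr (s + 1)
              + 1 / ((s + 1) * (s + 2))) * \<bar>f' b\<bar> powr q) powr (1/q)
    + (b - a) * (1/2) powr (1 - 1/q) * ((x - a) / (b - a)) powr (2 * (1 - 1/q))
        * (1 / (s + 2) * ((x - a) / (b - a)) powr (s + 2) * \<bar>f' b\<bar> powr q
           + (1 / (s + 2) * ((b - x) / (b - a)) powr (s + 2)
              - 1 / (s + 1) * ((b - x) / (b - a)) powr (s + 1)
              + 1 / ((s + 1) * (s + 2))) * \<bar>f' a\<bar> powr q) powr (1/q)"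
proof -
  \<comment> \<open>\<open>X\<close> and \<open>Y\<close> are the barycentric coordinates of
    \<open>x\<close> with respect to \<open>a\<close> and \<open>b\<close>. Thus the path from
    \<open>b\<close> towards \<open>a\<close> reaches \<open>x\<close> at \<open>t = X\<close>, and
    the one from \<open>a\<close> towards \<open>b\<close> at \<open>t = Y\<close>.\<close>
  define X where "X = (b - x) / (b - a)"
  define Y where "Y = (x - a) / (b - a)"
  have ab: "a < b" and x: "x \<in> {a..b}" and q: "q \<ge> 1" and s: "0 < s" by fact+
  have Xb: "X * (b - a) = b - x" and Yb: "Y * (b - a) = x - a"
    using ab by (simp_all add: X_def Y_def)
  have "0 \<le> X" "0 \<le> Y"
    using ab x by (simp_all add: X_def Y_def)
  moreover have "X + Y = 1"
    using ab by (simp add: X_def Y_def flip: add_divide_distrib)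
  ultimately have XY: "0 \<le> X" "X \<le> 1" "0 \<le> Y" "Y \<le> 1" "1 - X = Y" "1 - Y = X" "X + Y = 1"
    by auto
  have "X * a + Y * b = b - X * (b - a)"
    unfolding XY(5)[symmetric] by (simp add: algebra_simps)
  with Xb have xeq: "X * a + Y * b = x" by simp
  have sub: "{a..b} \<subseteq> I"
    using assms(1,3,4) by (meson atLeastAtMost_iff is_interval_1 subsetI)
  \<comment> \<open>The derivative is given on the interior of \<open>I\<close> and at
    \<open>a\<close> and \<open>b\<close>; together these cover \<open>{a..b}\<close>.\<close>
  have int: "u \<in> interior I \<union> {a, b}" if "u \<in> {a..b}" for u
  proof -
    have "{a<..<b} \<subseteq> interior I"
      using sub by (intro interior_maximal) auto
    then show ?thesis using that by (cases "u = a \<or> u = b") auto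
  qed
  have f: "(f has_real_derivative f' u) (at u within {a..b})" if "u \<in> {a..b}" for u
    using assms(6)[OF int[OF that]] sub by (rule DERIV_subset)
  then have cont: "continuous_on {a..b} f"
    by (rule DERIV_continuous_on)
  define \<Phi> where "\<Phi> u = integral {a..u} f" for u
  have \<Phi>: "(\<Phi> has_real_derivative f u) (at u within {a..b})" if "u \<in> {a..b}" for u
    unfolding \<Phi>_def by (rule integral_has_real_derivative[OF cont that])
  define A where "A = \<bar>f' a\<bar> powr q"
  define B where "B = \<bar>f' b\<bar> powr q"
  define J1 where "J1 = X * f x / (a - b) - (\<Phi> x - \<Phi> b) / (a - b)\<^sup>2"
  define J2 where "J2 = Y * f x / (b - a) - (\<Phi> x - \<Phi> a) / (b - a)\<^sup>2"
  have J1: "((\<lambda>t. t * f' (t * a + (1 - t) * b)) has_integral J1) {0..X}"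
    using montgomery_half_has_integral[of a b X "{a..b}" f f' \<Phi>] ab XY f \<Phi> xeq
    by (simp add: J1_def closed_segment_eq_real_ivl)
  have J2: "((\<lambda>t. t * f' (t * b + (1 - t) * a)) has_integral J2) {0..Y}"
    using montgomery_half_has_integral[of b a Y "{a..b}" f f' \<Phi>] ab XY f \<Phi> xeq
    by (simp add: J2_def closed_segment_eq_real_ivl add.commute)
  have conv: "\<bar>f' (t * p + (1 - t) * r)\<bar> powr q
      \<le> t powr s * \<bar>f' p\<bar> powr q + (1 - t) powr s * \<bar>f' r\<bar> powr q"
    if "0 \<le> t" "t \<le> 1" "p \<in> {a..b}" "r \<in> {a..b}" for t p r
    using assms(11) that unfolding s_convex_second_sense_def by auto
  have contR: "continuous_on {0..Z} (\<lambda>t. t powr s * C + (1 - t) powr s * D)" if "Z \<le> 1" for C D Z :: real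
    using that s
    by (intro continuous_on_add continuous_on_diff continuous_on_mult continuous_on_powr'
        continuous_on_const continuous_on_id) auto
  \<comment> \<open>The majorant comes from \<open>conv\<close> with endpoints \<open>a\<close> and
    \<open>b\<close>; its integral shows \<open>Y\<close> in place of \<open>1 - X\<close>. For
    \<open>b2\<close> the roles of \<open>a\<close> and \<open>b\<close> are exchanged.\<close>
  have b1: "\<bar>J1\<bar> \<le> (1/2) powr (1 - 1/q) * X powr (2 * (1 - 1/q))
      * (1 / (s + 2) * X powr (s + 2) * A
       + (1 / (s + 2) * Y powr (s + 2) - 1 / (s + 1) * Y powr (s + 1)
          + 1 / ((s + 1) * (s + 2))) * B) powr (1/q)"
    using weighted_power_mean_bound[OF XY(1) q contR[OF XY(2)] _ has_integral_powr_weight[OF XY(1,2) s] J1,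
        of A B] conv[of _ a b] XY ab by (simp add: A_def B_def)
  have b2: "\<bar>J2\<bar> \<le> (1/2) powr (1 - 1/q) * Y powr (2 * (1 - 1/q))
      * (1 / (s + 2) * Y powr (s + 2) * B
       + (1 / (s + 2) * X powr (s + 2) - 1 / (s + 1) * X powr (s + 1)
          + 1 / ((s + 1) * (s + 2))) * A) powr (1/q)"
    using weighted_power_mean_bound[OF XY(3) q contR[OF XY(4)] _ has_integral_powr_weight[OF XY(3,4) s] J2,
        of B A] conv[of _ b a] XY ab by (simp add: A_def B_def)
  \<comment> \<open>The divisor \<open>a - b\<close> in \<open>J1\<close> flips a sign, so the
    coefficients of \<open>f x\<close> add up to \<open>X + Y = 1\<close>, while
    \<open>\<Phi> x\<close> cancels and leaves the full integral of \<open>f\<close>.\<close>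
  have "J2 - J1 = (X + Y) * f x / (b - a) - (\<Phi> b - \<Phi> a) / (b - a)\<^sup>2"
  proof -
    have *: "X * f x / (a - b) = - (X * f x / (b - a))" "(a - b)\<^sup>2 = (b - a)\<^sup>2"
      by (simp_all add: minus_divide_right power2_commute)
    show ?thesis
      unfolding J1_def J2_def * by (simp add: add_divide_distrib diff_divide_distrib distrib_right)
  qed
  also have "\<dots> = (f x - 1 / (b - a) * integral {a..b} f) / (b - a)"
    using XY(7) by (simp add: \<Phi>_def diff_divide_distrib power2_eq_square)
  finally have "(b - a) * (J2 - J1) = f x - 1 / (b - a) * integral {a..b} f"
    using ab by simp
  then have "\<bar>f x - 1 / (b - a) * integral {a..b} f\<bar> = (b - a) * \<bar>J2 - J1\<bar>"
    using ab by (metis abs_mult abs_of_pos diff_gt_0_iff_gt)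
  also have "\<dots> \<le> (b - a) * (\<bar>J1\<bar> + \<bar>J2\<bar>)"
    using ab by (intro mult_left_mono) auto
  also have "\<dots> \<le> (b - a) * ((1/2) powr (1 - 1/q) * X powr (2 * (1 - 1/q))
      * (1 / (s + 2) * X powr (s + 2) * A
       + (1 / (s + 2) * Y powr (s + 2) - 1 / (s + 1) * Y powr (s + 1)
          + 1 / ((s + 1) * (s + 2))) * B) powr (1/q)
     + (1/2) powr (1 - 1/q) * Y powr (2 * (1 - 1/q))
      * (1 / (s + 2) * Y powr (s + 2) * B
       + (1 / (s + 2) * X powr (s + 2) - 1 / (s + 1) * X powr (s + 1)
          + 1 / ((s + 1) * (s + 2))) * A) powr (1/q))"
    using ab b1 b2 by (intro mult_left_mono add_mono) auto
  finally show ?thesis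
    unfolding X_def Y_def A_def B_def by (simp only: distrib_left mult.assoc)
qed

end
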